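(* Let $X$ be a compact, not singleton subset of a normed space $(E,\|\cdot\|)$ and let $Y$ be a convex subset of $E$ such that $X\subseteq\overline{Y}$. Then, for every convex set $S\subseteq Y$ dense in $Y$, for every upper semicontinuous bounded function $\gamma:X\to\mathbf{R}$ and for every $$\lambda>\frac{4\sup_X|\gamma|}{\operatorname{diam}(X)},$$ there exists $y^*\in S$ such that the function $x\mapsto\gamma(x)+\lambda\|x-y^*\|$ has at least two global maxima in $X$.
   Context: The normed space is real and the set $X$ is understood to be nonempty. Closure, density, compactness, semicontinuity and diameter refer to the norm. "At least two global maxima" means that there are at least two distinct points at which the function attains its global maximum over $X$. *)

theory Defs
  imports "HOL-Analysis.Analysis"
begin

definition upper_semicontinuous_on :: "'a::topological_space set \<Rightarrow> ('a \<Rightarrow> real) \<Rightarrow> bool" where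
  "upper_semicontinuous_on X f \<longleftrightarrow>
    (\<forall>x\<in>X. \<forall>a. f x < a \<longrightarrow> (\<forall>\<^sub>F z in at x within X. f z < a))"

definition has_two_global_maxima_on :: "'a set \<Rightarrow> ('a \<Rightarrow> real) \<Rightarrow> bool" where
  "has_two_global_maxima_on X f \<longleftrightarrow>
    (\<exists>x1 x2. x1 \<noteq> x2 \<and> is_arg_max f (\<lambda>x. x \<in> X) x1 \<and> is_arg_max f (\<lambda>x. x \<in> X) x2)"

end

(* If the maximizer over X is unique for every y in S, then on any compact convex subset K of S the
   convex function y |-> max_X (gamma + c |x - y|) attains its minimum at some y0, and the unique
   maximizer x0 at y0 forms a saddle point with it: moving from y0 slightly towards w in K, convexity
   in y bounds the value at w of the maximizers found on the way from below by the minimum, and these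
   maximizers converge to x0.  Taking for K the hull of a finite net of X in S makes the saddle value
   at most about sup |gamma|, while it is at least c diam X / 2 - sup |gamma|. *)

theory Submission
  imports Defs
begin

text \<open>Passes from the punctured filter of the definition to open sublevel sets, the form in
  which both covers and limits use semicontinuity.\<close>

lemma upper_semicontinuous_on_openin:
  assumes "upper_semicontinuous_on X f"
  shows "openin (top_of_set X) {x\<in>X. f x < a}"
proof (subst openin_subopen, intro ballI)
  fix x assume "x \<in> {x\<in>X. f x < a}"
  hence x: "x \<in> X" "f x < a" by auto
  with assms have "\<forall>\<^sub>F z in at x within X. f z < a"
    unfolding upper_semicontinuous_on_def by blast
  then obtain U where U: "open U" "x \<in> U" "\<And>z. z \<in> U \<Longrightarrow> z \<noteq> x \<Longrightarrow> z \<in> X \<Longrightarrow> f z < a"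
    unfolding eventually_at_topological by blast
  show "\<exists>T. openin (top_of_set X) T \<and> x \<in> T \<and> T \<subseteq> {x\<in>X. f x < a}"
    using U x by (intro exI[of _ "X \<inter> U"]) (auto simp: openin_open)
qed

lemma upper_semicontinuous_on_add_continuous:
  assumes f: "upper_semicontinuous_on X f" and h: "continuous_on X h"
  shows "upper_semicontinuous_on X (\<lambda>x. f x + h x)"
  unfolding upper_semicontinuous_on_def
proof (intro ballI allI impI)
  fix x a assume x: "x \<in> X" "f x + h x < a"
  define e where "e = (a - (f x + h x)) / 2"
  have e: "e > 0" using x by (simp add: e_def)
  have "\<forall>\<^sub>F z in at x within X. f z < f x + e"
    using f x(1) e unfolding upper_semicontinuous_on_def by simp
  moreover have "(h \<longlongrightarrow> h x) (at x within X)"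
    using h x by (simp add: continuous_on_def)
  hence "\<forall>\<^sub>F z in at x within X. h z < h x + e"
    using e by (simp add: order_tendsto_iff)
  ultimately show "\<forall>\<^sub>F z in at x within X. f z + h z < a"
    by eventually_elim (auto simp: e_def field_simps)
qed

lemma upper_semicontinuous_on_attains_sup:
  assumes X: "compact X" "X \<noteq> {}" and f: "upper_semicontinuous_on X f"
  shows "\<exists>x\<in>X. \<forall>z\<in>X. f z \<le> f x"
proof (rule ccontr)
  assume "\<not> ?thesis"
  hence cover: "\<exists>y\<in>X. f x < f y" if "x \<in> X" for x
    using that by (meson not_le)
  \<comment> \<open>Without a maximum these open sets cover \<open>X\<close>. A finite subcover,
    indexed by \<open>D\<close>, fails at the point of \<open>D\<close> where \<open>f\<close> is
    largest.\<close>
  define C where "C y = {x\<in>X. f x < f y}" for y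
  have "openin (top_of_set X) (C y)" for y
    unfolding C_def by (rule upper_semicontinuous_on_openin[OF f])
  moreover have "X \<subseteq> \<Union>(C ` X)" using cover unfolding C_def by blast
  ultimately obtain D' where D': "D' \<subseteq> C ` X" "finite D'" "X \<subseteq> \<Union>D'"
    using X(1)[unfolded compact_eq_openin_cover, rule_format, of "C ` X"] by blast
  then obtain D where "D \<subseteq> X" "finite D" "D' = C ` D"
    using finite_subset_image[OF D'(2,1)] by blast
  with D' have D: "D \<subseteq> X" "finite D" "\<And>x. x \<in> X \<Longrightarrow> \<exists>y\<in>D. f x < f y"
    by (auto simp: C_def)
  with X have "D \<noteq> {}" by auto
  with D(2) have "Max (f ` D) \<in> f ` D" by simp
  then obtain y where y: "y \<in> D" "f y = Max (f ` D)" by auto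
  then obtain z where "z \<in> D" "f y < f z" using D by blast
  thus False using y D(2) by (metis Max_ge finite_imageI image_eqI not_le)
qed

text \<open>The values \<open>f (x n)\<close> need not converge, so the limit is taken in lower
  bounds \<open>b n\<close> instead: if \<open>f z\<close> were below \<open>l\<close>, a number
  \<open>a\<close> strictly between would eventually separate \<open>f (x n)\<close> from
  \<open>b n\<close>.\<close>

lemma upper_semicontinuous_on_limit_ge:
  fixes b :: "nat \<Rightarrow> real"
  assumes f: "upper_semicontinuous_on X f" and z: "z \<in> X" and x: "\<And>n. x n \<in> X" "x \<longlonglongrightarrow> z"
    and b: "b \<longlonglongrightarrow> l" "\<And>n. b n \<le> f (x n)"
  shows "l \<le> f z"
proof (rule ccontr)
  assume "\<not> l \<le> f z"
  then obtain a where a: "f z < a" "a < l" using dense[of "f z" l] by auto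
  obtain U where U: "open U" "{x\<in>X. f x < a} = X \<inter> U"
    using upper_semicontinuous_on_openin[OF f] by (metis openin_open)
  have "z \<in> U" using U z a by blast
  hence "\<forall>\<^sub>F n in sequentially. x n \<in> U" using x(2) U(1) by (simp add: topological_tendstoD)
  moreover have "\<forall>\<^sub>F n in sequentially. a < b n" using b(1) a by (simp add: order_tendsto_iff)
  ultimately have "\<forall>\<^sub>F n in sequentially. False"
  proof eventually_elim
    case (elim n)
    hence "f (x n) < a" using U(2) x(1) by blast
    thus ?case using elim b(2)[of n] by simp
  qed
  thus False by simp
qed

text \<open>The single inequality encodes both halves of a saddle point: \<open>w = y0\<close> says
  that \<open>x0\<close> maximizes at \<open>y0\<close>, and \<open>x = x0\<close> says that
  \<open>y0\<close> minimizes at \<open>x0\<close>.\<close>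

lemma unique_maximizers_imp_saddle_point:
  fixes X K :: "'a::real_normed_vector set"
  assumes X: "compact X" "X \<noteq> {}" and K: "compact K" "convex K" "K \<noteq> {}"
    and \<gamma>: "upper_semicontinuous_on X \<gamma>" and c: "c \<ge> 0"
    and uniq: "\<And>y. y \<in> K \<Longrightarrow> \<not> has_two_global_maxima_on X (\<lambda>x. \<gamma> x + c * norm (x - y))"
  obtains x0 y0 where "x0 \<in> X" "y0 \<in> K"
    "\<And>x w. x \<in> X \<Longrightarrow> w \<in> K \<Longrightarrow> \<gamma> x + c * norm (x - y0) \<le> \<gamma> x0 + c * norm (x0 - w)"
proof -
  let ?f = "\<lambda>x y. \<gamma> x + c * norm (x - y)"
  have "\<exists>x\<in>X. \<forall>z\<in>X. ?f z y \<le> ?f x y" for y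
    by (intro upper_semicontinuous_on_attains_sup upper_semicontinuous_on_add_continuous X \<gamma>
        continuous_intros)
  then obtain m where m: "\<And>y. m y \<in> X" "\<And>y z. z \<in> X \<Longrightarrow> ?f z y \<le> ?f (m y) y"
    by metis
  define g where "g y = ?f (m y) y" for y
  have f_lip: "?f x y \<le> ?f x z + c * dist y z" for x y z
  proof -
    have "norm (x - y) \<le> norm (x - z) + dist y z"
      by (metis dist_commute dist_norm dist_triangle)
    hence "c * norm (x - y) \<le> c * (norm (x - z) + dist y z)" using c by (rule mult_left_mono)
    thus ?thesis by (simp add: algebra_simps)
  qed
  \<comment> \<open>A maximum of functions that are \<open>c\<close>-Lipschitz in \<open>y\<close>
    is \<open>c\<close>-Lipschitz; continuity then gives a minimizer on the compact
    \<open>K\<close>.\<close>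
  have g_le: "g y \<le> g z + c * dist y z" for y z
    using f_lip[of "m y" y z] m(2)[OF m(1), of y z] unfolding g_def by linarith
  have "c-lipschitz_on K g"
  proof (rule lipschitz_onI)
    show "dist (g y) (g z) \<le> c * dist y z" for y z
      using g_le[of y z] g_le[of z y] by (simp add: dist_real_def dist_commute abs_le_iff)
  qed (rule c)
  hence "continuous_on K g" by (rule lipschitz_on_continuous_on)
  then obtain y0 where y0: "y0 \<in> K" "\<And>y. y \<in> K \<Longrightarrow> g y0 \<le> g y"
    using continuous_attains_inf[OF K(1,3)] by blast
  have saddle: "g y0 \<le> ?f (m y0) w" if w: "w \<in> K" for w
  proof -
    define t :: "nat \<Rightarrow> real" where "t n = inverse (real (Suc n))" for n
    have t: "0 < t n" "t n \<le> 1" for n by (auto simp: t_def field_simps)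
    have t_lim: "t \<longlonglongrightarrow> 0" unfolding t_def by (rule LIMSEQ_inverse_real_of_nat)
    define y where "y n = (1 - t n) *\<^sub>R y0 + t n *\<^sub>R w" for n
    have yK: "y n \<in> K" for n
      unfolding y_def using K(2) y0(1) w t[of n] by (intro convexD) auto
    have "dist (y n) y0 = t n * norm (w - y0)" for n
    proof -
      have "y n - y0 = t n *\<^sub>R (w - y0)" by (simp add: y_def algebra_simps)
      thus ?thesis using t[of n] by (simp add: dist_norm)
    qed
    \<comment> \<open>Minimality gives \<open>g y0 \<le> g (y n)\<close>; replacing
      \<open>y n\<close> by \<open>y0\<close> costs a term that vanishes with \<open>t n\<close>. In
      the limit this makes \<open>z\<close> a maximizer at \<open>y0\<close>.\<close>
    hence at_y0: "g y0 \<le> ?f (m (y n)) y0 + c * (t n * norm (w - y0))" for n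
      using y0(2)[OF yK[of n]] f_lip[of "m (y n)" "y n" y0] unfolding g_def by simp
    \<comment> \<open>Convexity in \<open>y\<close> bounds the value at \<open>y n\<close> by the
      weighted mean of those at \<open>y0\<close> and \<open>w\<close>. The one at \<open>y0\<close>
      is at most \<open>g y0\<close>, so \<open>g y0\<close> cancels up to the factor
      \<open>t n > 0\<close>, leaving a bound without error term.\<close>
    have at_w: "g y0 \<le> ?f (m (y n)) w" for n
    proof -
      let ?x = "m (y n)"
      have "?x - y n = (1 - t n) *\<^sub>R (?x - y0) + t n *\<^sub>R (?x - w)"
        by (simp add: y_def algebra_simps)
      hence "norm (?x - y n) \<le> (1 - t n) * norm (?x - y0) + t n * norm (?x - w)"
        using norm_triangle_ineq[of "(1 - t n) *\<^sub>R (?x - y0)" "t n *\<^sub>R (?x - w)"] t[of n] by simp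
      hence "c * norm (?x - y n) \<le> c * ((1 - t n) * norm (?x - y0) + t n * norm (?x - w))"
        using c by (rule mult_left_mono)
      hence "?f ?x (y n) \<le> (1 - t n) * ?f ?x y0 + t n * ?f ?x w" by (simp add: algebra_simps)
      moreover have "(1 - t n) * ?f ?x y0 \<le> (1 - t n) * g y0"
        using m(2)[OF m(1)] t[of n] unfolding g_def by (intro mult_left_mono) auto
      moreover have "g y0 \<le> ?f ?x (y n)" using y0(2)[OF yK[of n]] by (simp add: g_def)
      ultimately have "g y0 \<le> (1 - t n) * g y0 + t n * ?f ?x w" by linarith
      hence "t n * g y0 \<le> t n * ?f ?x w" by (simp add: algebra_simps)
      thus ?thesis using t(1)[of n] by simp
    qed
    obtain z r where z: "z \<in> X" and r: "strict_mono r" "(\<lambda>n. m (y (r n))) \<longlonglongrightarrow> z"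
      using X(1)[unfolded compact_def, rule_format, of "\<lambda>n. m (y n)"] m(1) by (auto simp: comp_def)
    have tr: "(\<lambda>n. t (r n)) \<longlonglongrightarrow> 0"
      using LIMSEQ_subseq_LIMSEQ[OF t_lim r(1)] by (simp add: comp_def)
    \<comment> \<open>Only \<gamma> is merely semicontinuous, so the norm terms move into the
      convergent lower bound; the factor \<open>0\<close> is the limit of
      \<open>t (r n)\<close>.\<close>
    have "g y0 - c * (0 * norm (w - y0)) - c * norm (z - y0) \<le> \<gamma> z"
    proof (rule upper_semicontinuous_on_limit_ge[OF \<gamma> z m(1) r(2)])
      show "(\<lambda>n. g y0 - c * (t (r n) * norm (w - y0)) - c * norm (m (y (r n)) - y0))
          \<longlonglongrightarrow> g y0 - c * (0 * norm (w - y0)) - c * norm (z - y0)"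
        by (intro tendsto_intros tr r(2))
    qed (use at_y0 in \<open>simp add: algebra_simps\<close>)
    hence "g y0 \<le> ?f z y0" by simp
    hence "?f x y0 \<le> ?f z y0" if "x \<in> X" for x
      using m(2)[OF that, of y0] unfolding g_def by linarith
    hence "is_arg_max (\<lambda>x. ?f x y0) (\<lambda>x. x \<in> X) z" "is_arg_max (\<lambda>x. ?f x y0) (\<lambda>x. x \<in> X) (m y0)"
      using z m by (auto simp: is_arg_max_linorder)
    \<comment> \<open>Uniqueness makes the limit independent of \<open>w\<close>, so one point
      \<open>m y0\<close> serves every \<open>w\<close> in \<open>K\<close>.\<close>
    hence "z = m y0" using uniq[OF y0(1)] unfolding has_two_global_maxima_on_def by blast
    moreover have "g y0 - c * norm (z - w) \<le> \<gamma> z"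
    proof (rule upper_semicontinuous_on_limit_ge[OF \<gamma> z m(1) r(2)])
      show "(\<lambda>n. g y0 - c * norm (m (y (r n)) - w)) \<longlonglongrightarrow> g y0 - c * norm (z - w)"
        by (intro tendsto_intros r(2))
    qed (use at_w in \<open>simp add: algebra_simps\<close>)
    ultimately show ?thesis by simp
  qed
  show thesis
    by (rule that[OF m(1) y0(1)])
      (use m(2) saddle in \<open>blast intro: order_trans[OF _ saddle[unfolded g_def]]\<close>)
qed

lemma compact_imp_finite_net:
  fixes X :: "'a::metric_space set"
  assumes "compact X" "X \<subseteq> closure S" "e > 0"
  obtains N where "finite N" "N \<subseteq> S" "X \<subseteq> (\<Union>s\<in>N. ball s e)"
proof -
  have "X \<subseteq> (\<Union>s\<in>S. ball s e)"
    using assms(2,3) by (fastforce simp: closure_approachable)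
  from compactE_image[OF assms(1) _ this] that show thesis by (metis open_ball)
qed

theorem corollary1:
  fixes X Y S :: "'a::real_normed_vector set"
    and \<gamma> :: "'a \<Rightarrow> real"
    and c :: real
  assumes "compact X" and "X \<noteq> {}" and "\<not> is_singleton X"
    and "convex Y" and "X \<subseteq> closure Y"
    and "convex S" and "S \<subseteq> Y" and "Y \<subseteq> closure S"
    and "upper_semicontinuous_on X \<gamma>" and "bounded (\<gamma> ` X)"
    and "c > 4 * (SUP x\<in>X. \<bar>\<gamma> x\<bar>) / diameter X"
  shows "\<exists>y\<in>S. has_two_global_maxima_on X (\<lambda>x. \<gamma> x + c * norm (x - y))"
proof (rule ccontr)
  assume contra: "\<not> ?thesis"
  define M where "M = (SUP x\<in>X. \<bar>\<gamma> x\<bar>)"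
  have "bdd_above ((\<lambda>x. \<bar>\<gamma> x\<bar>) ` X)"
    using assms(10) by (auto simp: bounded_iff bdd_above_def)
  hence M: "\<bar>\<gamma> x\<bar> \<le> M" if "x \<in> X" for x
    unfolding M_def using that by (intro cSUP_upper)
  hence M0: "M \<ge> 0" using assms(2) by fastforce
  obtain a b where ab: "a \<in> X" "b \<in> X" "dist a b = diameter X"
    using diameter_compact_attained[OF assms(1,2)] by blast
  obtain p q where pq: "p \<in> X" "q \<in> X" "p \<noteq> q"
    using assms(2,3) by (metis ex_in_conv is_singletonI')
  hence D: "diameter X > 0"
    using diameter_bounded_bound[OF compact_imp_bounded[OF assms(1)], of p q]
    by (smt (verit) zero_less_dist_iff)
  have c: "c > 4 * M / diameter X" using assms(11) by (simp add: M_def)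
  hence cD: "4 * M < c * diameter X" using D by (simp add: field_simps)
  have c0: "c > 0" using c M0 D by (smt (verit) divide_nonneg_pos)
  \<comment> \<open>Chosen so that \<open>M + c * e = c * diameter X / 2 - M\<close>, the lower
    bound that the saddle value must respect; the assumption on \<open>c\<close> makes it
    positive.\<close>
  define e where "e = (c * diameter X / 2 - 2 * M) / c"
  have e: "e > 0" using cD c0 by (simp add: e_def)
  have "X \<subseteq> closure S" using assms(5,8) by (metis closure_minimal closed_closure subset_trans)
  \<comment> \<open>Centres in \<open>S\<close> keep the hull inside the convex \<open>S\<close>,
    and finiteness makes the hull compact, which \<open>S\<close> itself may not be.\<close>
  then obtain N where N: "finite N" "N \<subseteq> S" "X \<subseteq> (\<Union>s\<in>N. ball s e)"
    using compact_imp_finite_net[OF assms(1) _ e] by blast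
  let ?K = "convex hull N"
  have KS: "?K \<subseteq> S" using N(2) assms(6) by (rule hull_minimal)
  have K: "compact ?K" "convex ?K" "?K \<noteq> {}"
    using N assms(2) by (auto simp: finite_imp_compact_convex_hull)
  obtain x0 y0 where x0: "x0 \<in> X" "y0 \<in> ?K"
    and saddle: "\<And>x w. x \<in> X \<Longrightarrow> w \<in> ?K \<Longrightarrow>
      \<gamma> x + c * norm (x - y0) \<le> \<gamma> x0 + c * norm (x0 - w)"
  proof (rule unique_maximizers_imp_saddle_point[OF assms(1,2) K assms(9), of c])
    show "0 \<le> c" using c0 by simp
    show "\<not> has_two_global_maxima_on X (\<lambda>x. \<gamma> x + c * norm (x - y))" if "y \<in> ?K" for y
      using contra KS that by blast
  qed (rule that)
  obtain s where s: "s \<in> N" "dist s x0 < e" using N(3) x0(1) by auto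
  have "c * norm (x0 - s) < c * e"
    using s(2) c0 by (simp add: dist_norm norm_minus_commute)
  hence upper: "\<gamma> x0 + c * norm (x0 - s) < c * diameter X / 2 - M"
    using M[OF x0(1)] c0 by (simp add: e_def)
  \<comment> \<open>Averaging the saddle inequalities for \<open>a\<close> and \<open>b\<close> at
    \<open>w = s\<close> then gives at least \<open>c * diameter X / 2 - M\<close> on the right,
    against \<open>upper\<close>.\<close>
  have "diameter X \<le> norm (a - y0) + norm (b - y0)"
    using dist_triangle2[of a b y0] ab(3) by (simp add: dist_norm)
  hence "c * diameter X \<le> c * (norm (a - y0) + norm (b - y0))"
    using c0 by (intro mult_left_mono) auto
  moreover have "s \<in> ?K" using s(1) by (rule hull_inc)
  ultimately show False
    using saddle[OF ab(1), of s] saddle[OF ab(2), of s] M[OF ab(1)] M[OF ab(2)] upper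
    by (simp add: algebra_simps)
qed

end
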